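(* Let $c$ be a real number with $c<-\frac14$ and let $s\in\mathbb{C}\setminus\{0\}$ be neither real nor purely imaginary. Then the generalized Enneper surface $\mathbf{x}:\mathbb{C}\to\mathbb{R}^4_1$ with Weierstrass data $$\phi=z+1,\qquad \psi=\frac{c}{z},\qquad \mathrm{d}h=s\,z\,\mathrm{d}z$$ is embedded.
   Context: $\mathbb{R}^4_1$ is $\mathbb{R}^4$ with $\langle \mathbf{x},\mathbf{x}\rangle=x_1^2+x_2^2+x_3^2-x_4^2$. The surface with Weierstrass data $(\phi,\psi,\mathrm{d}h)$ is $\mathbf{x}=2\,\mathrm{Re}\int(\phi+\psi,-\mathrm{i}(\phi-\psi),1-\phi\psi,1+\phi\psi)\,\mathrm{d}h$ (defined up to translation); here it is a complete spacelike surface of zero mean curvature. "Embedded" means without self-intersection. *)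

theory Defs
  imports "HOL-Complex_Analysis.Complex_Analysis"
begin

(* The height differential is given by its coefficient: dh = h(z) dz.
   The four coefficients are the meromorphic functions denoted by the products, so poles of
   phi and psi cancelled by zeros of h are removed before evaluating; this matters
   because division by zero is 0 in HOL (e.g. (c/z) * z would be 0 at z = 0). *)
definition weierstrass_integrand ::
  "(complex \<Rightarrow> complex) \<Rightarrow> (complex \<Rightarrow> complex) \<Rightarrow> (complex \<Rightarrow> complex) \<Rightarrow> complex \<Rightarrow> complex ^ 4"
  where
  "weierstrass_integrand \<phi> \<psi> h z =
     vector [remove_sings (\<lambda>w. (\<phi> w + \<psi> w) * h w) z,
             remove_sings (\<lambda>w. - \<i> * (\<phi> w - \<psi> w) * h w) z,
             remove_sings (\<lambda>w. (1 - \<phi> w * \<psi> w) * h w) z,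
             remove_sings (\<lambda>w. (1 + \<phi> w * \<psi> w) * h w) z]"

(* For surfaces parametrized by the whole plane. When the integrand is entire, the integral
   does not depend on the path, so the segment from the base point p is taken; a is the
   image of p, so varying a gives all translates of the surface. *)
definition weierstrass_surface ::
  "complex \<Rightarrow> real ^ 4 \<Rightarrow> (complex \<Rightarrow> complex) \<Rightarrow> (complex \<Rightarrow> complex) \<Rightarrow> (complex \<Rightarrow> complex)
     \<Rightarrow> complex \<Rightarrow> real ^ 4"
  where
  "weierstrass_surface p a \<phi> \<psi> h z =
     a + (\<chi> k. 2 * Re (contour_integral (linepath p z) (\<lambda>w. vec_nth (weierstrass_integrand \<phi> \<psi> h w) k)))"

(* Absence of self-intersections involves neither the Lorentz metric nor regularity. *)
definition embedded :: "(complex \<Rightarrow> real ^ 4) \<Rightarrow> bool" where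
  "embedded x \<longleftrightarrow> inj x"

end

theory Submission
  imports Defs
begin

text \<open>
  All four Weierstrass forms are polynomial once the singularity at \<open>0\<close> is removed, so the
  coordinates are the real parts of explicit polynomials. In the null coordinates
  \<open>x\<^sub>4 + x\<^sub>3\<close> and \<open>x\<^sub>4 - x\<^sub>3\<close> the surface is, up to constants and real factors, given by
  \<open>Re (s z\<^sup>2)\<close> and \<open>Re (s (z + 1)\<^sup>2)\<close>.

  Suppose that two points \<open>z\<close>, \<open>w\<close> with difference \<open>d \<noteq> 0\<close> and sum \<open>m\<close> have the same image. The
  null coordinates say that \<open>s d m\<close> and \<open>s d (m + 2)\<close> have real part \<open>0\<close>. Hence \<open>s d\<close> is purely
  imaginary and \<open>m\<close> is real. The increments of the cubics behind \<open>x\<^sub>1\<close> and \<open>x\<^sub>2\<close> are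
  \<open>s d\<close> times \<open>K + c\<close> and \<open>K - c\<close>, where \<open>K = (3 m\<^sup>2 + d\<^sup>2) / 12 + m / 2\<close>. As \<open>s d\<close> is
  imaginary, their equations amount to the single complex equation \<open>K = c\<close>, that is,
  \<open>d\<^sup>2 = 12 (c + 1/4) - 3 (m + 1)\<^sup>2\<close>. For \<open>c < -1/4\<close> the right-hand side is negative, so \<open>d\<close> is
  purely imaginary. Since \<open>s d\<close> is imaginary too, \<open>s\<close> would be real, which is excluded.
\<close>

text \<open>
  Removing a singularity only looks at punctured neighbourhoods, so agreement off \<open>0\<close> with a
  continuous function identifies the integrand at \<open>0\<close> as well.
\<close>

lemma contour_integral_linepath_remove_sings:
  fixes f F F' :: "complex \<Rightarrow> complex"
  assumes eq: "\<And>w. w \<noteq> 0 \<Longrightarrow> f w = F' w"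
    and deriv: "\<And>w. (F has_field_derivative F' w) (at w)"
    and cont: "continuous_on UNIV F'"
  shows "contour_integral (linepath p z) (remove_sings f) = F z - F p"
proof -
  have "remove_sings f = F'"
  proof
    fix w :: complex
    have "eventually (\<lambda>x. x \<noteq> 0) (at w)"
      by (rule eventually_neq_at_within)
    then have ev: "eventually (\<lambda>x. F' x = f x) (at w)"
      by eventually_elim (simp add: eq)
    have "F' \<midarrow>w\<rightarrow> F' w"
      using cont by (simp add: continuous_on_eq_continuous_at isContD)
    with ev have "f \<midarrow>w\<rightarrow> F' w"
      by (rule Lim_transform_eventually[rotated])
    then show "remove_sings f w = F' w"
      by (rule remove_sings_eqI)
  qed
  moreover have "(F' has_contour_integral (F z - F p)) (linepath p z)"
    using contour_integral_primitive[of UNIV F F' "linepath p z"] deriv by simp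
  ultimately show ?thesis
    by (simp add: contour_integral_unique)
qed

text \<open>
  The integration constants are chosen so that \<open>F4 + F3\<close> and \<open>F4 - F3\<close>, which belong to the null
  coordinates, are multiples of the squares \<open>z\<^sup>2\<close> and \<open>(z + 1)\<^sup>2\<close>.
\<close>

lemma weierstrass_surface_coordinates:
  fixes c :: real and s p z :: complex and a :: "real ^ 4"
  defines "x \<equiv> weierstrass_surface p a
             (\<lambda>z. z + 1) (\<lambda>z. complex_of_real c / z) (\<lambda>z. s * z)"
    and "F1 \<equiv> \<lambda>z. s * (z ^ 3 / 3 + z\<^sup>2 / 2 + complex_of_real c * z)"
    and "F2 \<equiv> \<lambda>z. - \<i> * (s * (z ^ 3 / 3 + z\<^sup>2 / 2 - complex_of_real c * z))"
    and "F3 \<equiv> \<lambda>z. s * (z\<^sup>2 / 2 - complex_of_real c * (z + 1)\<^sup>2 / 2)"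
    and "F4 \<equiv> \<lambda>z. s * (z\<^sup>2 / 2 + complex_of_real c * (z + 1)\<^sup>2 / 2)"
  shows "vec_nth (x z) 1 = vec_nth a 1 + 2 * Re (F1 z - F1 p)"
    and "vec_nth (x z) 2 = vec_nth a 2 + 2 * Re (F2 z - F2 p)"
    and "vec_nth (x z) 3 = vec_nth a 3 + 2 * Re (F3 z - F3 p)"
    and "vec_nth (x z) 4 = vec_nth a 4 + 2 * Re (F4 z - F4 p)"
proof -
  let ?c = "complex_of_real c"
  have vector_4: "vec_nth (vector [t, u, v, w] :: complex ^ 4) 1 = t"
    "vec_nth (vector [t, u, v, w] :: complex ^ 4) 2 = u"
    "vec_nth (vector [t, u, v, w] :: complex ^ 4) 3 = v"
    "vec_nth (vector [t, u, v, w] :: complex ^ 4) 4 = w" for t u v w :: complex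
    unfolding vector_def by simp_all
  have "contour_integral (linepath p z) (remove_sings (\<lambda>w. (w + 1 + ?c / w) * (s * w))) = F1 z - F1 p"
    unfolding F1_def
    by (rule contour_integral_linepath_remove_sings[where F' = "\<lambda>w. s * (w\<^sup>2 + w + ?c)"])
       (auto intro!: derivative_eq_intros continuous_intros simp: field_simps power2_eq_square)
  then show "vec_nth (x z) 1 = vec_nth a 1 + 2 * Re (F1 z - F1 p)"
    by (simp add: x_def weierstrass_surface_def weierstrass_integrand_def vector_4)
  have "contour_integral (linepath p z) (remove_sings (\<lambda>w. - \<i> * (w + 1 - ?c / w) * (s * w))) = F2 z - F2 p"
    unfolding F2_def
    by (rule contour_integral_linepath_remove_sings[where F' = "\<lambda>w. - \<i> * (s * (w\<^sup>2 + w - ?c))"])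
       (auto intro!: derivative_eq_intros continuous_intros simp: field_simps power2_eq_square)
  then show "vec_nth (x z) 2 = vec_nth a 2 + 2 * Re (F2 z - F2 p)"
    by (simp add: x_def weierstrass_surface_def weierstrass_integrand_def vector_4)
  have "contour_integral (linepath p z) (remove_sings (\<lambda>w. (1 - (w + 1) * (?c / w)) * (s * w))) = F3 z - F3 p"
    unfolding F3_def
    by (rule contour_integral_linepath_remove_sings[where F' = "\<lambda>w. s * (w - ?c * (w + 1))"])
       (auto intro!: derivative_eq_intros continuous_intros simp: field_simps power2_eq_square)
  then show "vec_nth (x z) 3 = vec_nth a 3 + 2 * Re (F3 z - F3 p)"
    by (simp add: x_def weierstrass_surface_def weierstrass_integrand_def vector_4)
  have "contour_integral (linepath p z) (remove_sings (\<lambda>w. (1 + (w + 1) * (?c / w)) * (s * w))) = F4 z - F4 p"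
    unfolding F4_def
    by (rule contour_integral_linepath_remove_sings[where F' = "\<lambda>w. s * (w + ?c * (w + 1))"])
       (auto intro!: derivative_eq_intros continuous_intros simp: field_simps power2_eq_square)
  then show "vec_nth (x z) 4 = vec_nth a 4 + 2 * Re (F4 z - F4 p)"
    by (simp add: x_def weierstrass_surface_def weierstrass_integrand_def vector_4)
qed

text \<open>
  The hypotheses are the equations of a self-intersection in terms of \<open>d = z - w\<close> and
  \<open>m = z + w\<close>. A nonzero solution would have \<open>s d\<close> imaginary and \<open>d\<^sup>2\<close> real and negative, so both
  \<open>d\<close> and \<open>s d\<close> would lie on the imaginary axis although \<open>s\<close> is not real.
\<close>

lemma self_intersection_imp_eq:
  fixes c :: real and s d m :: complex
  defines "K \<equiv> (3 * m\<^sup>2 + d\<^sup>2) / 12 + m / 2"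
  assumes c: "c < - 1 / 4" and s: "Im s \<noteq> 0"
    and e1: "Re (s * d * (K + complex_of_real c)) = 0"
    and e2: "Im (s * d * (K - complex_of_real c)) = 0"
    and e3: "Re (s * d * m) = 0"
    and e4: "Re (s * d * (m + 2)) = 0"
  shows "d = 0"
proof (rule ccontr)
  assume d: "d \<noteq> 0"
  have "s * d * (m + 2) = s * d * m + 2 * (s * d)"
    by (simp add: algebra_simps)
  with e3 e4 have Re_sd: "Re (s * d) = 0"
    by simp
  define t where "t = Im (s * d)"
  have sd: "s * d = \<i> * complex_of_real t"
    using Re_sd by (simp add: t_def complex_eq_iff)
  have t: "t \<noteq> 0"
    using sd s d by auto
  have Im_m: "Im m = 0"
    using e3 t unfolding sd by simp
  have "Im K = 0"
    using e1 t unfolding sd by simp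
  moreover have "Re K = c"
    using e2 t unfolding sd by simp
  ultimately have K: "K = complex_of_real c"
    by (simp add: complex_eq_iff)
  define r where "r = Re m"
  have m: "m = complex_of_real r"
    using Im_m by (simp add: r_def complex_eq_iff)
  have "d\<^sup>2 = 12 * complex_of_real c - 3 * m\<^sup>2 - 6 * m"
    using K by (simp add: K_def field_simps)
  then have d2: "d\<^sup>2 = complex_of_real (12 * c - 3 * r\<^sup>2 - 6 * r)"
    by (simp add: m)
  have "12 * c - 3 * r\<^sup>2 - 6 * r = 12 * (c + 1 / 4) - 3 * (r + 1)\<^sup>2"
    by (simp add: power2_eq_square algebra_simps)
  also have "\<dots> < 0"
  proof -
    have "12 * (c + 1 / 4) < 0"
      using c by simp
    moreover have "0 \<le> 3 * (r + 1)\<^sup>2"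
      by simp
    ultimately show ?thesis
      by linarith
  qed
  finally have neg: "12 * c - 3 * r\<^sup>2 - 6 * r < 0" .
  have "Re (d\<^sup>2) < 0" "Im (d\<^sup>2) = 0"
    using neg by (simp_all add: d2)
  then have "Re d * Re d < Im d * Im d" "Re d * Im d = 0"
    by (auto simp: power2_eq_square)
  then have "Re d = 0"
    by (metis mult_eq_0_iff mult_zero_left not_less zero_le_square)
  moreover from this have "Im d \<noteq> 0"
    using d by (simp add: complex_eq_iff)
  ultimately show False
    using Re_sd s by simp
qed

theorem proposition8p3:
  fixes c :: real and s p :: complex and a :: "real ^ 4"
  assumes "c < - 1 / 4"
    and "s \<noteq> 0" and "Im s \<noteq> 0" and "Re s \<noteq> 0"
  shows "embedded (weierstrass_surface p a
           (\<lambda>z. z + 1) (\<lambda>z. complex_of_real c / z) (\<lambda>z. s * z))"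
  unfolding embedded_def
proof (rule injI)
  let ?x = "weierstrass_surface p a (\<lambda>z. z + 1) (\<lambda>z. complex_of_real c / z) (\<lambda>z. s * z)"
  let ?c = "complex_of_real c"
  fix z w
  assume eq: "?x z = ?x w"
  define d where "d = z - w"
  define m where "m = z + w"
  define K where "K = (3 * m\<^sup>2 + d\<^sup>2) / 12 + m / 2"
  note coords = weierstrass_surface_coordinates[of p a c s]
  have x1: "Re (s * (z ^ 3 / 3 + z\<^sup>2 / 2 + ?c * z) - s * (w ^ 3 / 3 + w\<^sup>2 / 2 + ?c * w)) = 0"
    using arg_cong[OF eq, of "\<lambda>v. vec_nth v 1"] unfolding coords by simp
  have x2: "Re (- \<i> * (s * (z ^ 3 / 3 + z\<^sup>2 / 2 - ?c * z)) - - \<i> * (s * (w ^ 3 / 3 + w\<^sup>2 / 2 - ?c * w))) = 0"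
    using arg_cong[OF eq, of "\<lambda>v. vec_nth v 2"] unfolding coords by simp
  have x3: "Re (s * (z\<^sup>2 / 2 - ?c * (z + 1)\<^sup>2 / 2) - s * (w\<^sup>2 / 2 - ?c * (w + 1)\<^sup>2 / 2)) = 0"
    using arg_cong[OF eq, of "\<lambda>v. vec_nth v 3"] unfolding coords by simp
  have x4: "Re (s * (z\<^sup>2 / 2 + ?c * (z + 1)\<^sup>2 / 2) - s * (w\<^sup>2 / 2 + ?c * (w + 1)\<^sup>2 / 2)) = 0"
    using arg_cong[OF eq, of "\<lambda>v. vec_nth v 4"] unfolding coords by simp
  have "s * (z ^ 3 / 3 + z\<^sup>2 / 2 + ?c * z) - s * (w ^ 3 / 3 + w\<^sup>2 / 2 + ?c * w) = s * d * (K + ?c)"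
    by (simp add: K_def d_def m_def field_simps power2_eq_square power3_eq_cube)
  with x1 have e1: "Re (s * d * (K + ?c)) = 0"
    by simp
  have "- \<i> * (s * (z ^ 3 / 3 + z\<^sup>2 / 2 - ?c * z)) - - \<i> * (s * (w ^ 3 / 3 + w\<^sup>2 / 2 - ?c * w))
      = - \<i> * (s * d * (K - ?c))"
    by (simp add: K_def d_def m_def field_simps power2_eq_square power3_eq_cube)
  with x2 have "Re (- \<i> * (s * d * (K - ?c))) = 0"
    by (simp only:)
  then have e2: "Im (s * d * (K - ?c)) = 0"
    by simp
  have "(s * (z\<^sup>2 / 2 + ?c * (z + 1)\<^sup>2 / 2) - s * (w\<^sup>2 / 2 + ?c * (w + 1)\<^sup>2 / 2))
      + (s * (z\<^sup>2 / 2 - ?c * (z + 1)\<^sup>2 / 2) - s * (w\<^sup>2 / 2 - ?c * (w + 1)\<^sup>2 / 2)) = s * d * m"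
    by (simp add: d_def m_def field_simps power2_eq_square)
  then have e3: "Re (s * d * m) = 0"
    using x3 x4 by (metis add_0 plus_complex.sel(1))
  have "(s * (z\<^sup>2 / 2 + ?c * (z + 1)\<^sup>2 / 2) - s * (w\<^sup>2 / 2 + ?c * (w + 1)\<^sup>2 / 2))
      - (s * (z\<^sup>2 / 2 - ?c * (z + 1)\<^sup>2 / 2) - s * (w\<^sup>2 / 2 - ?c * (w + 1)\<^sup>2 / 2))
      = ?c * (s * d * (m + 2))"
    by (simp add: d_def m_def field_simps power2_eq_square)
  then have "Re (?c * (s * d * (m + 2))) = 0"
    using x3 x4 by (metis diff_0_right minus_complex.sel(1))
  then have "c * Re (s * d * (m + 2)) = 0"
    by (simp only: Re_complex_of_real Im_complex_of_real times_complex.sel)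
  then have e4: "Re (s * d * (m + 2)) = 0"
    using assms(1) by simp
  have "d = 0"
    using assms(1,3) e1 e2 e3 e4 unfolding K_def by (rule self_intersection_imp_eq)
  then show "z = w"
    by (simp add: d_def)
qed

end
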